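(* Let $\mathrm{Pas}=\mathcal{R}\big(\tfrac{1}{1-t},\tfrac{t}{1-t}\big)$ and $\mathrm{Pas}^{-1}=\mathcal{R}\big(\tfrac{1}{1+t},\tfrac{t}{1+t}\big)$, and let $A_i(t)$ denote the $i$th Eulerian polynomial. Then for every $i\ge0$, $$\mathrm{Der}^{2i}(\mathrm{Pas})=\mathcal{R}\Big(\frac{A_i(t)}{(1-t)^{i+1}},\frac{tA_i(t)}{(1-t)^{i+1}}\Big),\qquad \mathrm{Der}^{2i+1}(\mathrm{Pas})=\mathcal{R}\Big(\frac{A_{i+1}(t)}{(1-t)^{i+2}},\frac{tA_i(t)}{(1-t)^{i+1}}\Big),$$ $$\mathrm{Der}^{2i}(\mathrm{Pas}^{-1})=\mathcal{R}\Big(\frac{A_i(-t)}{(1+t)^{i+1}},\frac{tA_i(-t)}{(1+t)^{i+1}}\Big),\qquad \mathrm{Der}^{2i+1}(\mathrm{Pas}^{-1})=\mathcal{R}\Big(\frac{A_{i+1}(-t)}{(1+t)^{i+2}},\frac{tA_i(-t)}{(1+t)^{i+1}}\Big).$$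
   Context: For formal power series $d(t),h(t)$ with $d(0)\neq0$, $h(0)=0$, $h'(0)\neq0$, $\mathcal{R}(d(t),h(t))$ is the infinite lower triangular matrix with $(n,k)$-entry $[t^n]\,d(t)h(t)^k$ ($n,k\ge0$). $\mathrm{Der}(\mathcal{R}(d(t),h(t)))=\mathcal{R}(h'(t),t\,d(t))$ and $\mathrm{Der}^k$ is $\mathrm{Der}$ iterated $k$ times. The Eulerian polynomial is $A_n(t)=\sum_{\sigma\in S_n}t^{\mathrm{des}(\sigma)}$ for $n\ge1$, where $\mathrm{des}(\sigma)$ is the number of $i\in\{1,\dots,n-1\}$ with $\sigma(i)>\sigma(i+1)$; and $A_0(t)=1$. (So $A_1=1$, $A_2=1+t$, $A_3=1+4t+t^2$.) *)

theory Defs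
  imports
    "HOL-Computational_Algebra.Polynomial_FPS"
    "HOL-Combinatorics.Permutations"
begin

type_synonym 'a inf_matrix = "nat \<Rightarrow> nat \<Rightarrow> 'a"

definition riordan_pair :: "'a::field fps \<Rightarrow> 'a fps \<Rightarrow> bool" where
  "riordan_pair d h \<longleftrightarrow>
     fps_nth d 0 \<noteq> 0 \<and> fps_nth h 0 = 0 \<and> fps_nth (fps_deriv h) 0 \<noteq> 0"

definition riordan :: "'a::field fps \<Rightarrow> 'a fps \<Rightarrow> 'a inf_matrix" where
  "riordan d h = (\<lambda>n k. fps_nth (d * h ^ k) n)"

lemma riordan_inject:
  assumes "riordan_pair d h" and "riordan d h = riordan d' h'"
  shows "d' = d" and "h' = h"
proof -
  have col: "d * h ^ k = d' * h' ^ k" for k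
    using assms(2) by (auto simp: riordan_def fps_eq_iff fun_eq_iff)
  show "d' = d" using col[of 0] by simp
  moreover have "d \<noteq> 0" using assms(1) by (auto simp: riordan_pair_def)
  ultimately show "h' = h" using col[of 1] by simp
qed

text \<open>
  The derivation acts on matrices: the pair is recovered from the matrix, which determines it
  by \<open>riordan_inject\<close>. On matrices that are not Riordan arrays the value is
  irrelevant; Riordan arrays are mapped to Riordan arrays, so iterating is unproblematic.
\<close>

definition Der :: "'a::field inf_matrix \<Rightarrow> 'a inf_matrix" where
  "Der M = (let (d, h) = (THE (d, h). riordan_pair d h \<and> M = riordan d h)
            in riordan (fps_deriv h) (fps_X * d))"

lemma Der_riordan:
  assumes "riordan_pair d h"
  shows "Der (riordan d h) = riordan (fps_deriv h) (fps_X * d)"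
proof -
  have "(THE (d', h'). riordan_pair d' h' \<and> riordan d h = riordan d' h') = (d, h)"
    using assms riordan_inject[OF assms] by (intro the_equality) auto
  then show ?thesis by (simp add: Der_def)
qed

lemma riordan_pair_Der:
  "riordan_pair d h \<Longrightarrow> riordan_pair (fps_deriv h) (fps_X * d)"
  by (simp add: riordan_pair_def)

definition Pas :: "'a::field inf_matrix" where
  "Pas = riordan (1 / (1 - fps_X)) (fps_X / (1 - fps_X))"

definition Pas_inv :: "'a::field inf_matrix" where
  "Pas_inv = riordan (1 / (1 + fps_X)) (fps_X / (1 + fps_X))"

definition des :: "nat \<Rightarrow> (nat \<Rightarrow> nat) \<Rightarrow> nat" where
  "des n \<sigma> = card {i \<in> {1..n - 1}. \<sigma> i > \<sigma> (i + 1)}"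

definition eulerian_poly :: "nat \<Rightarrow> 'a::field poly" where
  "eulerian_poly n =
     (if n = 0 then 1 else (\<Sum>\<sigma> | \<sigma> permutes {1..n}. monom 1 (des n \<sigma>)))"

definition eulerian_fps :: "nat \<Rightarrow> 'a::field fps" where
  "eulerian_fps n = fps_of_poly (eulerian_poly n)"

definition eulerian_fps_neg :: "nat \<Rightarrow> 'a::field fps" where
  "eulerian_fps_neg n = fps_of_poly (pcompose (eulerian_poly n) [:0, - 1:])"

end

theory Submission
  imports Defs
begin

text \<open>
  Put \<open>E\<^sub>i(t) = A\<^sub>i(t) / (1 - t)\<^sup>i\<^sup>+\<^sup>1\<close>. Inserting the largest letter into a permutation of
  \<open>{1..n}\<close> with \<open>d\<close> descents preserves the number of descents in \<open>d + 1\<close> positions and increases it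
  by one in the other \<open>n - d\<close>, which gives
  \<open>A\<^sub>n\<^sub>+\<^sub>1 = (1 + n t) A\<^sub>n + t (1 - t) A\<^sub>n'\<close>, that is, \<open>(t E\<^sub>i)' = E\<^sub>i\<^sub>+\<^sub>1\<close>. This identity is invariant
  under \<open>t \<mapsto> c t\<close>, and for every such sequence of series, \<open>Der\<close> sends \<open>(E\<^sub>i, t E\<^sub>i)\<close> to
  \<open>(E\<^sub>i\<^sub>+\<^sub>1, t E\<^sub>i)\<close> and then to \<open>(E\<^sub>i\<^sub>+\<^sub>1, t E\<^sub>i\<^sub>+\<^sub>1)\<close>. The choices \<open>c = 1\<close> and \<open>c = - 1\<close> are the
  two families.
\<close>

section \<open>Inserting the largest letter into a permutation\<close>

text \<open>
  If \<open>\<sigma>\<close> permutes \<open>{1..n}\<close> then \<open>\<sigma> \<circ> shift_from n q\<close> is the word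
  \<open>\<sigma>(1), \<dots>, \<sigma>(q), n + 1, \<sigma>(q + 1), \<dots>, \<sigma>(n)\<close>.
\<close>

definition shift_from :: "nat \<Rightarrow> nat \<Rightarrow> nat \<Rightarrow> nat" where
  "shift_from n q i =
     (if i = Suc q then Suc n else if Suc q < i \<and> i \<le> Suc n then i - 1 else i)"

lemma shift_from_permutes:
  assumes "q \<le> n"
  shows "shift_from n q permutes {1..Suc n}"
proof (rule bij_imp_permutes)
  have "inj_on (shift_from n q) {1..Suc n}"
    by (auto simp: inj_on_def shift_from_def split: if_splits)
  moreover have "shift_from n q ` {1..Suc n} \<subseteq> {1..Suc n}"
    using assms by (auto simp: shift_from_def)
  ultimately show "bij_betw (shift_from n q) {1..Suc n} {1..Suc n}"
    by (simp add: bij_betw_def endo_inj_surj)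
qed (use assms in \<open>auto simp: shift_from_def\<close>)

text \<open>Both \<open>\<sigma>\<close> and \<open>\<sigma>'\<close> fix \<open>n + 1\<close>, so
  the place where \<open>n + 1\<close> occurs in the word gives back \<open>q\<close>; then
  \<open>shift_from n q\<close>, being surjective, cancels on the right. Surjectivity follows by
  counting: \<open>n! (n + 1) = (n + 1)!\<close>.\<close>

lemma bij_betw_permutes_insert:
  "bij_betw (\<lambda>(\<sigma>, q). \<sigma> \<circ> shift_from n q)
     ({\<sigma>. \<sigma> permutes {1..n}} \<times> {..n}) {\<tau>. \<tau> permutes {1..Suc n}}"
    (is "bij_betw ?f (?S \<times> _) ?T")
proof -
  have "\<sigma> \<circ> shift_from n q permutes {1..Suc n}" if "\<sigma> permutes {1..n}" "q \<le> n" for \<sigma> q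
    using permutes_compose[OF shift_from_permutes[OF that(2)] permutes_subset[OF that(1)]]
    by simp
  then have image: "?f ` (?S \<times> {..n}) \<subseteq> ?T" by auto
  have "inj_on ?f (?S \<times> {..n})"
  proof (rule inj_onI, clarsimp simp del: One_nat_def)
    fix \<sigma> q \<sigma>' q'
    assume \<sigma>: "\<sigma> permutes {1..n}" and \<sigma>': "\<sigma>' permutes {1..n}"
      and q: "q \<le> n" "q' \<le> n"
      and eq: "\<sigma> \<circ> shift_from n q = \<sigma>' \<circ> shift_from n q'"
    have top: "\<sigma> (Suc n) = Suc n" "\<sigma>' (Suc n) = Suc n"
      using \<sigma> \<sigma>' by (auto simp: permutes_def)
    have "\<sigma>' (shift_from n q' (Suc q)) = \<sigma>' (Suc n)"
      using fun_cong[OF eq, of "Suc q"] top by (simp add: shift_from_def)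
    then have "shift_from n q' (Suc q) = Suc n"
      using permutes_inj[OF \<sigma>'] by (auto dest: injD)
    then have "q = q'"
      using q by (auto simp: shift_from_def split: if_splits)
    moreover have "surj (shift_from n q)"
      using permutes_surj[OF shift_from_permutes[OF q(1)]] .
    ultimately show "\<sigma> = \<sigma>' \<and> q = q'"
      using eq surj_fun_eq[of "shift_from n q" UNIV \<sigma> \<sigma>'] by auto
  qed
  moreover have "card (?S \<times> {..n}) = card ?T"
    by (simp add: card_permutations card_cartesian_product)
  moreover have "finite ?T" by (rule finite_permutations) simp
  ultimately show ?thesis
    using image by (simp add: bij_betw_def card_image card_subset_eq)
qed

text \<open>The new letter exceeds its neighbours: position \<open>q\<close> is no longer a descent,
  position \<open>q + 1\<close> is one unless \<open>q = n\<close>, and all other comparisons are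
  between the same letters as before. For \<open>q \<in> D\<close> the loss and the gain cancel; for
  \<open>q = n\<close> there is neither.\<close>

lemma des_insert:
  assumes \<sigma>: "\<sigma> permutes {1..n}" and q: "q \<le> n"
  defines "D \<equiv> {i \<in> {1..n - 1}. \<sigma> i > \<sigma> (i + 1)}"
  shows "des (Suc n) (\<sigma> \<circ> shift_from n q) =
           (if q \<in> insert n D then des n \<sigma> else Suc (des n \<sigma>))"
proof -
  have top: "\<sigma> (Suc n) = Suc n" using \<sigma> by (auto simp: permutes_def)
  have bound: "\<sigma> i < Suc n" if "i \<in> {1..n}" for i
    using permutes_in_image[OF \<sigma>, of i] that by simp
  define L where "L = {i \<in> D. i < q}"
  \<comment> \<open>Behind the gap every letter has moved one place to the right, hence
    \<open>Suc\<close>.\<close>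
  define R where "R = Suc ` {i \<in> D. i > q}"
  have finD: "finite D" by (simp add: D_def)
  have "{i \<in> {1..n}. (\<sigma> \<circ> shift_from n q) i > (\<sigma> \<circ> shift_from n q) (i + 1)} =
          L \<union> R \<union> (if q = n then {} else {Suc q})" (is "?D' = ?rhs")
  proof (rule set_eqI)
    fix i
    consider "i < q" | "i = q" | "i = Suc q" | "i > Suc q" by linarith
    then show "i \<in> ?D' \<longleftrightarrow> i \<in> ?rhs"
    proof cases
      case 1
      then show ?thesis using q by (auto simp: shift_from_def L_def R_def D_def)
    next
      case 2
      then show ?thesis using q top bound[of q]
        by (auto simp: shift_from_def L_def R_def D_def)
    next
      case 3
      then show ?thesis using q top bound[of "Suc q"]
        by (auto simp: shift_from_def L_def R_def D_def)
    next
      case 4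
      then obtain j where j: "i = Suc j" "j > q" by (cases i) auto
      then show ?thesis using q
        by (auto simp: shift_from_def L_def R_def D_def)
    qed
  qed
  then have "des (Suc n) (\<sigma> \<circ> shift_from n q) = card ?rhs"
    by (simp add: des_def)
  also have "\<dots> = card L + card R + (if q = n then 0 else 1)"
  proof -
    have "L \<inter> R = {}" "Suc q \<notin> L \<union> R" "finite L" "finite R"
      using finD by (auto simp: L_def R_def)
    then show ?thesis by (simp add: card_Un_disjoint)
  qed
  also have "card R = card {i \<in> D. i > q}"
    unfolding R_def by (rule card_image) simp
  also have "card L + card {i \<in> D. i > q} = card (D - {q})"
  proof -
    have "D - {q} = L \<union> {i \<in> D. i > q}" by (auto simp: L_def)
    moreover have "L \<inter> {i \<in> D. i > q} = {}" by (auto simp: L_def)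
    ultimately show ?thesis using finD by (simp add: L_def card_Un_disjoint)
  qed
  finally have *: "des (Suc n) (\<sigma> \<circ> shift_from n q) =
      card (D - {q}) + (if q = n then 0 else 1)" .
  have "des n \<sigma> = card D" by (simp add: des_def D_def)
  \<comment> \<open>So for \<open>q = n\<close> the removal of \<open>q\<close> leaves
    \<open>D\<close> unchanged.\<close>
  moreover have "n \<notin> D" by (auto simp: D_def)
  moreover have "card D = Suc (card (D - {q}))" if "q \<in> D"
    using card.remove[OF finD that] .
  ultimately show ?thesis using * by auto
qed

text \<open>The number of positions of each kind depends on \<open>d = des n \<sigma>\<close>.
  Expressing the factor \<open>d\<close> by the operator \<open>t d/dt\<close> makes the right side
  linear in the monomial, so that it can be summed over all \<open>\<sigma>\<close>.\<close>

lemma sum_monom_des_insert: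
  assumes \<sigma>: "\<sigma> permutes {1..n}"
  shows "(\<Sum>q\<le>n. monom (1::'a::field) (des (Suc n) (\<sigma> \<circ> shift_from n q))) =
           (1 + of_nat n * [:0, 1:]) * monom 1 (des n \<sigma>) +
           [:0, 1:] * [:1, - 1:] * pderiv (monom 1 (des n \<sigma>))"
proof -
  define D where "D = {i \<in> {1..n - 1}. \<sigma> i > \<sigma> (i + 1)}"
  define d where "d = des n \<sigma>"
  have d: "card D = d" by (simp add: D_def d_def des_def)
  have D: "finite D" "n \<notin> D" "insert n D \<subseteq> {..n}" by (auto simp: D_def)
  then have cI: "card (insert n D) = Suc d" using d by simp
  \<comment> \<open>This makes the truncated difference \<open>n - d\<close> a true one, so that
    \<open>of_nat\<close> distributes over it.\<close>
  have le: "d \<le> n" using card_mono[OF _ D(3)] cI by simp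
  have "(\<Sum>q\<le>n. monom (1::'a) (des (Suc n) (\<sigma> \<circ> shift_from n q))) =
          (\<Sum>q\<le>n. if q \<in> insert n D then monom 1 d else monom 1 (Suc d))"
    using des_insert[OF \<sigma>] by (intro sum.cong refl) (auto simp: D_def d_def)
  also have "\<dots> = (\<Sum>q\<in>insert n D. monom 1 d) + (\<Sum>q\<in>{..n} - insert n D. monom 1 (Suc d))"
    by (subst sum.subset_diff[OF D(3)]) (auto simp: add.commute)
  also have "\<dots> = of_nat (Suc d) * monom 1 d + of_nat (n - d) * monom 1 (Suc d)"
    using cI D by (simp add: card_Diff_subset)
  also have "\<dots> = (1 + of_nat n * [:0, 1:]) * monom 1 d +
      [:0, 1:] * [:1, - 1:] * pderiv (monom (1::'a) d)"
  proof -
    let ?X = "[:0, 1:] :: 'a poly" and ?m = "monom (1::'a) d"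
    have X_mult: "monom 1 (Suc d) = ?X * ?m" by (simp add: monom_Suc)
    have "?X * [:1, - 1:] * pderiv ?m = (1 - ?X) * (?X * pderiv ?m)"
      by (simp add: one_pCons mult_ac)
    also have "?X * pderiv ?m = of_nat d * ?m"
      by (cases d) (simp_all add: pderiv_monom of_nat_poly smult_monom flip: monom_Suc)
    finally show ?thesis
      using le by (simp only: of_nat_diff X_mult) (simp add: algebra_simps)
  qed
  finally show ?thesis by (simp add: d_def)
qed

section \<open>The recurrence for the Eulerian polynomials\<close>

lemma eulerian_poly_Suc:
  "eulerian_poly (Suc n) =
     (1 + of_nat n * [:0, 1:]) * eulerian_poly n +
     [:0, 1:] * [:1, - 1:] * pderiv (eulerian_poly n :: 'a::field poly)"
proof -
  \<comment> \<open>The sum also covers the separate case \<open>m = 0\<close>: the empty set has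
    one permutation, without descents.\<close>
  have perms: "eulerian_poly m = (\<Sum>\<sigma> | \<sigma> permutes {1..m}. monom (1::'a) (des m \<sigma>))" for m
    by (simp add: eulerian_poly_def des_def)
  have "eulerian_poly (Suc n) =
      (\<Sum>\<sigma> | \<sigma> permutes {1..n}. \<Sum>q\<le>n. monom (1::'a) (des (Suc n) (\<sigma> \<circ> shift_from n q)))"
    unfolding perms sum.cartesian_product
    by (subst sum.reindex_bij_betw[OF bij_betw_permutes_insert[of n], symmetric])
       (simp add: case_prod_unfold)
  also have "\<dots> = (\<Sum>\<sigma> | \<sigma> permutes {1..n}.
      (1 + of_nat n * [:0, 1:]) * monom 1 (des n \<sigma>) +
      [:0, 1:] * [:1, - 1:] * pderiv (monom (1::'a) (des n \<sigma>)))"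
    by (intro sum.cong refl sum_monom_des_insert) simp
  also have "\<dots> = (1 + of_nat n * [:0, 1:]) * eulerian_poly n +
      [:0, 1:] * [:1, - 1:] * pderiv (eulerian_poly n)"
    unfolding perms higher_pderiv_sum[of 1, simplified]
      sum.distrib sum_distrib_left ..
  finally show ?thesis .
qed

section \<open>Scaled Eulerian series and their quotients\<close>

definition eulerian_scaled :: "'a::field \<Rightarrow> nat \<Rightarrow> 'a fps" where
  "eulerian_scaled c n = fps_of_poly (pcompose (eulerian_poly n) [:0, c:])"

lemma eulerian_scaled_0 [simp]: "eulerian_scaled c 0 = 1"
  by (simp add: eulerian_scaled_def eulerian_poly_def pcompose_1)

lemma eulerian_scaled_1: "eulerian_scaled 1 n = eulerian_fps n"
  by (simp add: eulerian_scaled_def eulerian_fps_def)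

lemma eulerian_scaled_minus_1: "eulerian_scaled (- 1) n = eulerian_fps_neg n"
  by (simp add: eulerian_scaled_def eulerian_fps_neg_def)

text \<open>The inner derivative \<open>c\<close> of the chain rule is absorbed by the prefactor:
  \<open>c t A'(c t) = t (A(c t))'\<close>. This is why \<open>fps_X\<close> appears there without a
  factor \<open>c\<close>.\<close>

lemma eulerian_scaled_Suc:
  fixes c :: "'a::field"
  shows "eulerian_scaled c (Suc n) =
    (1 + of_nat n * fps_const c * fps_X) * eulerian_scaled c n +
    fps_X * (1 - fps_const c * fps_X) * fps_deriv (eulerian_scaled c n)"
proof -
  let ?A = "eulerian_poly n :: 'a poly" and ?c = "[:0, c:]"
  have "pcompose (eulerian_poly (Suc n)) ?c =
      (1 + of_nat n * ?c) * pcompose ?A ?c + [:0, 1:] * (1 - ?c) * pderiv (pcompose ?A ?c)"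
  proof -
    have "?c = [:0, 1:] * [:c:]" "pcompose [:0, 1:] ?c = ?c"
      "pcompose [:1, - 1:] ?c = 1 - ?c" "pcompose (of_nat n) ?c = of_nat n"
      by (simp_all add: pcompose_pCons of_nat_poly one_pCons)
    then show ?thesis
      unfolding eulerian_poly_Suc pcompose_add pcompose_mult pcompose_1 pderiv_pcompose
      by (simp add: pderiv_pCons mult_ac)
  qed
  moreover have "fps_of_poly (of_nat n :: 'a poly) = of_nat n"
    by (simp only: of_nat_poly fps_of_poly_const fps_of_nat)
  moreover have "fps_of_poly ?c = fps_const c * fps_X" "fps_of_poly [:0, 1:] = (fps_X :: 'a fps)"
    by (simp_all add: fps_of_poly_pCons)
  ultimately show ?thesis
    by (simp only: eulerian_scaled_def fps_of_poly_add fps_of_poly_mult fps_of_poly_diff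
          fps_of_poly_pderiv fps_of_poly_1 mult.assoc)
qed

text \<open>With \<open>Q = eulerian_scaled c n\<close>, the derivative over the denominator
  \<open>(1 - c t)^(n + 2)\<close> has numerator \<open>(1 - c t) (Q + t Q') + (n + 1) c t Q = (1 +
  n c t) Q + t (1 - c t) Q'\<close>, which is the recurrence.\<close>

lemma fps_deriv_eulerian_quotient:
  fixes c :: "'a::field"
  defines "E \<equiv> \<lambda>n. eulerian_scaled c n / (1 - fps_const c * fps_X) ^ (n + 1)"
  shows "fps_deriv (fps_X * E n) = E (Suc n)"
proof -
  let ?U = "1 - fps_const c * fps_X :: 'a fps" and ?Q = "eulerian_scaled c"
  define V where "V = inverse ?U"
  have UV: "?U * V = 1" unfolding V_def by (rule inverse_mult_eq_1') simp
  have dV: "fps_deriv V = fps_const c * V ^ 2"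
    unfolding V_def by (subst fps_inverse_deriv) (simp_all)
  have dV_power: "fps_deriv (V ^ Suc n) = of_nat (Suc n) * fps_const c * V ^ Suc (Suc n)"
    unfolding fps_deriv_power dV
    by (simp only: fps_of_nat power2_eq_square power_Suc mult_ac diff_Suc_1)
  have E: "E m = ?Q m * V ^ Suc m" for m
    by (simp add: E_def V_def fps_divide_unit fps_inverse_power fps_inverse_mult)
  have "fps_deriv (fps_X * E n) =
      (?Q n + fps_X * fps_deriv (?Q n)) * V ^ Suc n +
      of_nat (Suc n) * fps_const c * fps_X * ?Q n * V ^ Suc (Suc n)"
    unfolding E fps_deriv_mult dV_power by (simp add: algebra_simps del: of_nat_Suc)
  \<comment> \<open>The inserted factor \<open>?U * V = 1\<close> brings both summands to the power
    \<open>V ^ Suc (Suc n)\<close>.\<close>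
  also have "\<dots> = (?Q n + fps_X * fps_deriv (?Q n)) * (?U * V) * V ^ Suc n +
      of_nat (Suc n) * fps_const c * fps_X * ?Q n * V ^ Suc (Suc n)"
    by (simp only: UV mult_1_right)
  also have "\<dots> = E (Suc n)"
    unfolding E eulerian_scaled_Suc by (simp add: algebra_simps)
  finally show ?thesis .
qed

section \<open>Iterating the derivation\<close>

lemma Der_funpow_riordan:
  fixes E :: "nat \<Rightarrow> 'a::field fps"
  assumes E0: "fps_nth (E 0) 0 \<noteq> 0" and E_Suc: "\<And>n. fps_deriv (fps_X * E n) = E (Suc n)"
  shows "(Der ^^ (2 * i)) (riordan (E 0) (fps_X * E 0)) = riordan (E i) (fps_X * E i)"
    and "(Der ^^ (2 * i + 1)) (riordan (E 0) (fps_X * E 0)) =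
           riordan (E (Suc i)) (fps_X * E i)"
proof -
  \<comment> \<open>The constant term of \<open>(t E)'\<close> is that of \<open>E\<close>, so it
    stays nonzero along the sequence. Thus every pair met in the iteration is a Riordan pair and
    \<open>Der_riordan\<close> applies.\<close>
  have nz: "fps_nth (E n) 0 \<noteq> 0" for n
  proof (induction n)
    case (Suc n)
    then show ?case by (simp flip: E_Suc)
  qed (rule E0)
  have odd: "Der (riordan (E n) (fps_X * E n)) = riordan (E (Suc n)) (fps_X * E n)"
    and even: "Der (riordan (E (Suc n)) (fps_X * E n)) =
      riordan (E (Suc n)) (fps_X * E (Suc n))" for n
    \<comment> \<open>The product rule would break up \<open>fps_deriv (fps_X * E n)\<close> before
      \<open>E_Suc\<close> can rewrite it.\<close>
    using nz by (auto simp: Der_riordan riordan_pair_def E_Suc simp del: fps_deriv_mult)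
  show "(Der ^^ (2 * i)) (riordan (E 0) (fps_X * E 0)) = riordan (E i) (fps_X * E i)"
    by (induction i) (simp_all add: odd even)
  then show "(Der ^^ (2 * i + 1)) (riordan (E 0) (fps_X * E 0)) =
      riordan (E (Suc i)) (fps_X * E i)"
    by (simp add: odd)
qed

lemma Der_funpow_eulerian:
  fixes c :: "'a::field"
  defines "U \<equiv> 1 - fps_const c * fps_X"
  shows "(Der ^^ (2 * i)) (riordan (1 / U) (fps_X / U)) =
      riordan (eulerian_scaled c i / U ^ (i + 1)) (fps_X * eulerian_scaled c i / U ^ (i + 1))"
    and "(Der ^^ (2 * i + 1)) (riordan (1 / U) (fps_X / U)) =
      riordan (eulerian_scaled c (i + 1) / U ^ (i + 2))
              (fps_X * eulerian_scaled c i / U ^ (i + 1))"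
proof -
  define E where "E n = eulerian_scaled c n / U ^ (n + 1)" for n
  have U: "fps_nth (U ^ n) 0 = 1" for n by (simp add: U_def fps_nth_power_0)
  \<comment> \<open>Dividing by a unit is multiplying by its inverse, so \<open>fps_X\<close> can be
    moved out of the quotient.\<close>
  have XE: "fps_X * eulerian_scaled c n / U ^ (n + 1) = fps_X * E n" for n
    using U[of "n + 1"] by (simp add: E_def fps_divide_unit mult.assoc)
  \<comment> \<open>As \<open>eulerian_scaled c 0 = 1\<close>, the starting array is the one of
    \<open>E 0\<close>.\<close>
  have E0: "1 / U = E 0" "fps_X / U = fps_X * E 0"
    using XE[of 0] by (simp_all add: E_def)
  have "fps_nth (E 0) 0 \<noteq> 0"
    using U[of 1] by (simp add: E_def fps_divide_unit)
  moreover have "fps_deriv (fps_X * E n) = E (Suc n)" for n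
    unfolding E_def U_def by (rule fps_deriv_eulerian_quotient)
  ultimately have
    "(Der ^^ (2 * i)) (riordan (E 0) (fps_X * E 0)) = riordan (E i) (fps_X * E i)"
    "(Der ^^ (2 * i + 1)) (riordan (E 0) (fps_X * E 0)) = riordan (E (Suc i)) (fps_X * E i)"
    using Der_funpow_riordan[of E i] by blast+
  moreover have "E (Suc i) = eulerian_scaled c (i + 1) / U ^ (i + 2)"
    by (simp add: E_def)
  ultimately show
    "(Der ^^ (2 * i)) (riordan (1 / U) (fps_X / U)) =
      riordan (eulerian_scaled c i / U ^ (i + 1)) (fps_X * eulerian_scaled c i / U ^ (i + 1))"
    "(Der ^^ (2 * i + 1)) (riordan (1 / U) (fps_X / U)) =
      riordan (eulerian_scaled c (i + 1) / U ^ (i + 2))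
              (fps_X * eulerian_scaled c i / U ^ (i + 1))"
    unfolding E0 XE by (simp_all only: E_def)
qed

theorem theorem5p2:
  fixes i :: nat
  shows
    "(Der ^^ (2 * i)) (Pas :: 'a::field inf_matrix) =
       riordan (eulerian_fps i / (1 - fps_X) ^ (i + 1))
               (fps_X * eulerian_fps i / (1 - fps_X) ^ (i + 1)) \<and>
     (Der ^^ (2 * i + 1)) (Pas :: 'a inf_matrix) =
       riordan (eulerian_fps (i + 1) / (1 - fps_X) ^ (i + 2))
               (fps_X * eulerian_fps i / (1 - fps_X) ^ (i + 1)) \<and>
     (Der ^^ (2 * i)) (Pas_inv :: 'a inf_matrix) =
       riordan (eulerian_fps_neg i / (1 + fps_X) ^ (i + 1))
               (fps_X * eulerian_fps_neg i / (1 + fps_X) ^ (i + 1)) \<and>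
     (Der ^^ (2 * i + 1)) (Pas_inv :: 'a inf_matrix) =
       riordan (eulerian_fps_neg (i + 1) / (1 + fps_X) ^ (i + 2))
               (fps_X * eulerian_fps_neg i / (1 + fps_X) ^ (i + 1))"
proof -
  have "1 - fps_const 1 * fps_X = (1 - fps_X :: 'a fps)"
    and "1 - fps_const (- 1) * fps_X = (1 + fps_X :: 'a fps)"
    by (simp_all flip: fps_const_neg)
  then show ?thesis
    unfolding Pas_def Pas_inv_def
    using Der_funpow_eulerian[of i "1 :: 'a"] Der_funpow_eulerian[of i "- 1 :: 'a"]
    by (simp only: eulerian_scaled_1 eulerian_scaled_minus_1 simp_thms)
qed

end
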